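(* $\mathbf{H}\mathbf{S}\{\underline{\mathrm{Sb}}(E) : E=E|E^{-1}\}=\mathbf{S}\mathbf{H}\{\underline{\mathrm{Sb}}(E) : E=E|E^{-1}\}$.
   Context: For binary relations, $R|S=\{\langle x,z\rangle:\exists y\,(\langle x,y\rangle\in R\wedge\langle y,z\rangle\in S)\}$, $R^{-1}=\{\langle x,y\rangle:\langle y,x\rangle\in R\}$; $E=E|E^{-1}$ says $E$ is an equivalence relation on its field. $\underline{\mathrm{Sb}}(E)=\langle \mathrm{Sb}(E),\cup,E\setminus(\cdot),|,{}^{-1},\mathrm{Id}\cap E\rangle$ where $\mathrm{Sb}(E)$ is the power set of $E$ and $\mathrm{Id}$ the identity relation. For a class $\mathsf K$ of similar algebras, $\mathbf{H}\mathsf K$ is the class of homomorphic images of members of $\mathsf K$ and $\mathbf{S}\mathsf K$ is the class of algebras isomorphic to a subalgebra of a member of $\mathsf K$. *)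

theory Defs
  imports Main
begin

text \<open>
  Algebras of the similarity type of \<open>Sb(E)\<close>. The operations are total on the type, but only
  their restrictions to the carrier matter: membership in all the classes below is insensitive to
  values outside the carrier. The carrier is nonempty because it contains the constant.
\<close>

record 'a alg =
  carrier :: "'a set"
  join :: "'a \<Rightarrow> 'a \<Rightarrow> 'a"
  cmpl :: "'a \<Rightarrow> 'a"
  rmult :: "'a \<Rightarrow> 'a \<Rightarrow> 'a"
  conv :: "'a \<Rightarrow> 'a"
  ident :: "'a"

definition is_alg :: "'a alg \<Rightarrow> bool" where
  "is_alg A \<longleftrightarrow>
     (\<forall>x\<in>carrier A. \<forall>y\<in>carrier A. join A x y \<in> carrier A) \<and>
     (\<forall>x\<in>carrier A. cmpl A x \<in> carrier A) \<and>
     (\<forall>x\<in>carrier A. \<forall>y\<in>carrier A. rmult A x y \<in> carrier A) \<and>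
     (\<forall>x\<in>carrier A. conv A x \<in> carrier A) \<and>
     ident A \<in> carrier A"

definition is_hom :: "('a \<Rightarrow> 'b) \<Rightarrow> 'a alg \<Rightarrow> 'b alg \<Rightarrow> bool" where
  "is_hom h A B \<longleftrightarrow>
     h ` carrier A \<subseteq> carrier B \<and>
     (\<forall>x\<in>carrier A. \<forall>y\<in>carrier A. h (join A x y) = join B (h x) (h y)) \<and>
     (\<forall>x\<in>carrier A. h (cmpl A x) = cmpl B (h x)) \<and>
     (\<forall>x\<in>carrier A. \<forall>y\<in>carrier A. h (rmult A x y) = rmult B (h x) (h y)) \<and>
     (\<forall>x\<in>carrier A. h (conv A x) = conv B (h x)) \<and>
     h (ident A) = ident B"

definition isomorphic :: "'a alg \<Rightarrow> 'b alg \<Rightarrow> bool" where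
  "isomorphic A B \<longleftrightarrow> (\<exists>h. is_hom h A B \<and> bij_betw h (carrier A) (carrier B))"

definition subalgebra :: "'a alg \<Rightarrow> 'a alg \<Rightarrow> bool" where
  "subalgebra A B \<longleftrightarrow>
     is_alg A \<and> carrier A \<subseteq> carrier B \<and>
     (\<forall>x\<in>carrier A. \<forall>y\<in>carrier A. join A x y = join B x y) \<and>
     (\<forall>x\<in>carrier A. cmpl A x = cmpl B x) \<and>
     (\<forall>x\<in>carrier A. \<forall>y\<in>carrier A. rmult A x y = rmult B x y) \<and>
     (\<forall>x\<in>carrier A. conv A x = conv B x) \<and>
     ident A = ident B"

text \<open>
  The class operators H and S. The elements of the algebras in the resulting class may be of a
  type different from those of the algebras in \<open>K\<close>. Up to isomorphism nothing new is obtained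
  by varying that type; see \<open>H_cls_same_type\<close> and \<open>S_cls_same_type\<close> below.
\<close>

definition H_cls :: "'a alg set \<Rightarrow> 'b alg set" where
  "H_cls K = {B. is_alg B \<and> (\<exists>A\<in>K. \<exists>h. is_hom h A B \<and> h ` carrier A = carrier B)}"

definition S_cls :: "'a alg set \<Rightarrow> 'b alg set" where
  "S_cls K = {B. is_alg B \<and> (\<exists>A\<in>K. \<exists>C. subalgebra C A \<and> isomorphic B C)}"

definition Sb :: "'a rel \<Rightarrow> 'a rel alg" where
  "Sb E = \<lparr> carrier = Pow E, join = (\<union>), cmpl = (\<lambda>R. E - R),
            rmult = (O), conv = converse, ident = Id \<inter> E \<rparr>"

definition Sb_cls :: "'a rel alg set" where
  "Sb_cls = {Sb E | E. E = E O E\<inverse>}"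

lemma is_alg_Sb:
  assumes E: "E = E O E\<inverse>"
  shows "is_alg (Sb E)"
proof -
  have s: "E\<inverse> = E"
    using E by (metis converse_converse converse_relcomp)
  then have t: "E O E = E"
    using E by simp
  have "R O S \<subseteq> E" if "R \<subseteq> E" "S \<subseteq> E" for R S
    using relcomp_mono[OF that] t by simp
  moreover have "R\<inverse> \<subseteq> E" if "R \<subseteq> E" for R
    using converse_mono[of R E] that s by simp
  ultimately show ?thesis
    by (auto simp: is_alg_def Sb_def)
qed

lemma H_cls_same_type:
  fixes K :: "'a alg set" and B :: "'b alg"
  assumes "B \<in> H_cls K"
  shows "\<exists>D \<in> (H_cls K :: 'a alg set). isomorphic B D"
proof -
  obtain A h where B: "is_alg B" and A: "A \<in> K" and h: "is_hom h A B"
    and im: "h ` carrier A = carrier B"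
    using assms by (auto simp: H_cls_def)
  define s where "s = inv_into (carrier A) h"
  have hs: "h (s b) = b" if "b \<in> carrier B" for b
    using that im unfolding s_def by (metis f_inv_into_f)
  define D where "D = \<lparr> carrier = s ` carrier B,
    join = (\<lambda>x y. s (join B (h x) (h y))), cmpl = (\<lambda>x. s (cmpl B (h x))),
    rmult = (\<lambda>x y. s (rmult B (h x) (h y))), conv = (\<lambda>x. s (conv B (h x))),
    ident = s (ident B) \<rparr>"
  have D: "is_alg D"
    using B by (auto simp: is_alg_def D_def hs)
  have sB: "is_hom s B D"
    by (auto simp: is_hom_def D_def hs)
  have "inj_on s (carrier B)"
    using hs by (metis inj_onI)
  then have iso: "isomorphic B D"
    using sB by (auto simp: isomorphic_def bij_betw_def D_def)
  have mem: "h x \<in> carrier B" if "x \<in> carrier A" for x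
    using that im by auto
  have "is_hom (s \<circ> h) A D"
    using h by (auto simp: is_hom_def D_def hs mem)
  moreover have "(s \<circ> h) ` carrier A = carrier D"
    unfolding image_comp[symmetric] im by (simp add: D_def)
  ultimately have "D \<in> H_cls K"
    using A D unfolding H_cls_def by blast
  then show ?thesis
    using iso by blast
qed

lemma S_cls_same_type:
  fixes K :: "'a alg set" and B :: "'b alg"
  assumes "B \<in> S_cls K"
  shows "\<exists>D \<in> (S_cls K :: 'a alg set). isomorphic B D"
proof -
  obtain A C where A: "A \<in> K" and C: "subalgebra C A" and iso: "isomorphic B C"
    using assms by (auto simp: S_cls_def)
  have "is_hom id C C" "bij_betw id (carrier C) (carrier C)"
    by (auto simp: is_hom_def)
  then have "isomorphic C C"
    unfolding isomorphic_def by blast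
  moreover have "is_alg C"
    using C by (simp add: subalgebra_def)
  ultimately have "C \<in> S_cls K"
    using A C unfolding S_cls_def by blast
  then show ?thesis
    using iso by blast
qed

end

theory Submission
  imports Defs
begin

text \<open>
  The inclusion \<open>SH \<subseteq> HS\<close> holds for every class of algebras: pull the subalgebra of the
  homomorphic image back to its preimage. The inclusion \<open>HS \<subseteq> SH\<close> follows from the congruence
  extension property of the algebras \<open>Sb E\<close>. If \<open>f\<close> is a homomorphism defined on a subalgebra \<open>C\<close>
  of \<open>Sb E\<close>, then \<open>I = {u \<in> C. f u = f {}}\<close> is an ideal of \<open>C\<close>; the relation
  \<open>\<exists>u\<in>I. x \<union> u = y \<union> u\<close> is a congruence of \<open>Sb E\<close> because \<open>I\<close> is closed under
  \<open>u \<mapsto> E O u\<close> and \<open>u \<mapsto> u O E\<close>, and it restricts to the kernel of \<open>f\<close> on \<open>C\<close>.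
\<close>

section \<open>Homomorphisms and isomorphisms\<close>

lemma isomorphic_refl: "isomorphic A A"
proof -
  have "is_hom id A A" "bij_betw id (carrier A) (carrier A)"
    by (auto simp: is_hom_def)
  then show ?thesis
    unfolding isomorphic_def by blast
qed

lemma is_hom_comp:
  assumes "is_hom f A B" "is_hom g B C"
  shows "is_hom (g \<circ> f) A C"
proof -
  have "f x \<in> carrier B" if "x \<in> carrier A" for x
    using assms(1) that by (auto simp: is_hom_def)
  then show ?thesis
    using assms by (auto simp: is_hom_def)
qed

text \<open>Both \<open>B\<close> and \<open>D\<close> are the quotient of \<open>A\<close> by the
  common kernel, so \<open>f x \<mapsto> q x\<close> is a well-defined isomorphism.\<close>

lemma isomorphic_if_same_kernel:
  assumes A: "is_alg A"
    and f: "is_hom f A B" "f ` carrier A = carrier B"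
    and q: "is_hom q A D" "q ` carrier A = carrier D"
    and ker: "\<And>x y. x \<in> carrier A \<Longrightarrow> y \<in> carrier A \<Longrightarrow> q x = q y \<longleftrightarrow> f x = f y"
  shows "isomorphic B D"
proof -
  \<comment> \<open>The preimage chosen by \<open>inv_into\<close> is immaterial: two preimages of
    \<open>b\<close> are identified by \<open>f\<close>, hence by \<open>q\<close>.\<close>
  define k where "k b = q (inv_into (carrier A) f b)" for b
  have kf: "k (f x) = q x" if x: "x \<in> carrier A" for x
  proof -
    have "inv_into (carrier A) f (f x) \<in> carrier A" "f (inv_into (carrier A) f (f x)) = f x"
      using x by (auto intro: inv_into_into f_inv_into_f)
    then show ?thesis
      using ker x by (simp add: k_def)
  qed
  have im: "k ` carrier B = carrier D"
    unfolding f(2)[symmetric] q(2)[symmetric] image_image by (rule image_cong) (auto simp: kf)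
  have inj: "inj_on k (carrier B)"
    unfolding f(2)[symmetric] by (auto simp: inj_on_def kf ker)
  have opsB: "join B (f x) (f y) = f (join A x y)" "rmult B (f x) (f y) = f (rmult A x y)"
    "cmpl B (f x) = f (cmpl A x)" "conv B (f x) = f (conv A x)" "ident B = f (ident A)"
    if "x \<in> carrier A" "y \<in> carrier A" for x y
    using f(1) that by (auto simp: is_hom_def)
  have opsD: "join D (q x) (q y) = q (join A x y)" "rmult D (q x) (q y) = q (rmult A x y)"
    "cmpl D (q x) = q (cmpl A x)" "conv D (q x) = q (conv A x)" "ident D = q (ident A)"
    if "x \<in> carrier A" "y \<in> carrier A" for x y
    using q(1) that by (auto simp: is_hom_def)
  \<comment> \<open>Writing \<open>carrier B\<close> as the image of \<open>f\<close> turns the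
    quantifiers over \<open>B\<close> into quantifiers over \<open>A\<close>, where
    \<open>kf\<close> evaluates \<open>k\<close>.\<close>
  have "is_hom k B D"
    unfolding is_hom_def im unfolding f(2)[symmetric] ball_simps(9)
    using A by (auto simp: is_alg_def opsB opsD kf)
  then show ?thesis
    using im inj by (auto simp: isomorphic_def bij_betw_def)
qed

text \<open>An isomorphism \<open>h\<close> and \<open>id\<close> are both injective on
  \<open>A\<close>, so their kernels coincide.\<close>

lemma isomorphic_sym:
  assumes "is_alg A" "isomorphic A B"
  shows "isomorphic B A"
proof -
  obtain h where h: "is_hom h A B" "bij_betw h (carrier A) (carrier B)"
    using assms(2) by (auto simp: isomorphic_def)
  have "is_hom id A A"
    by (auto simp: is_hom_def)
  then show ?thesis
    by (rule isomorphic_if_same_kernel[OF assms(1) h(1) bij_betw_imp_surj_on[OF h(2)]])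
      (use h(2) in \<open>auto simp: bij_betw_def inj_on_def\<close>)
qed

section \<open>Congruences and quotients\<close>

definition congruence :: "'a alg \<Rightarrow> ('a \<Rightarrow> 'a \<Rightarrow> bool) \<Rightarrow> bool" where
  "congruence A \<theta> \<longleftrightarrow>
     (\<forall>x\<in>carrier A. \<theta> x x) \<and>
     (\<forall>x\<in>carrier A. \<forall>y\<in>carrier A. \<theta> x y \<longrightarrow> \<theta> y x) \<and>
     (\<forall>x\<in>carrier A. \<forall>y\<in>carrier A. \<forall>z\<in>carrier A. \<theta> x y \<longrightarrow> \<theta> y z \<longrightarrow> \<theta> x z) \<and>
     (\<forall>x\<in>carrier A. \<forall>y\<in>carrier A. \<forall>x'\<in>carrier A. \<forall>y'\<in>carrier A.
        \<theta> x y \<longrightarrow> \<theta> x' y' \<longrightarrow>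
        \<theta> (join A x x') (join A y y') \<and> \<theta> (rmult A x x') (rmult A y y')) \<and>
     (\<forall>x\<in>carrier A. \<forall>y\<in>carrier A.
        \<theta> x y \<longrightarrow> \<theta> (cmpl A x) (cmpl A y) \<and> \<theta> (conv A x) (conv A y))"

text \<open>The quotient lives on class representatives, so that it has elements of the same type.\<close>

lemma quotient_exists:
  fixes A :: "'a alg"
  assumes A: "is_alg A" and \<theta>: "congruence A \<theta>"
  obtains D :: "'a alg" and q where "is_alg D" "is_hom q A D" "q ` carrier A = carrier D"
    "\<And>x y. x \<in> carrier A \<Longrightarrow> y \<in> carrier A \<Longrightarrow> q x = q y \<longleftrightarrow> \<theta> x y"
proof -
  have refl: "\<theta> x x" if "x \<in> carrier A" for x
    using \<theta> that unfolding congruence_def by blast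
  have sym: "\<theta> y x" if "\<theta> x y" "x \<in> carrier A" "y \<in> carrier A" for x y
    using \<theta> that unfolding congruence_def by blast
  have trans: "\<theta> x z" if "\<theta> x y" "\<theta> y z" "x \<in> carrier A" "y \<in> carrier A" "z \<in> carrier A" for x y z
    using \<theta> that unfolding congruence_def by blast
  define q where "q x = (SOME y. y \<in> carrier A \<and> \<theta> x y)" for x
  have q: "q x \<in> carrier A \<and> \<theta> x (q x)" if "x \<in> carrier A" for x
    unfolding q_def by (rule someI[of _ x]) (use that refl in auto)
  have q_iff: "q x = q y \<longleftrightarrow> \<theta> x y" if xy: "x \<in> carrier A" "y \<in> carrier A" for x y
  proof
    assume "q x = q y"
    then show "\<theta> x y"
      using q[OF xy(1)] q[OF xy(2)] xy trans sym by metis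
  next
    assume "\<theta> x y"
    \<comment> \<open>Related elements have the same class as a predicate, so \<open>SOME\<close>
      picks the same representative for both.\<close>
    then have "(\<lambda>z. z \<in> carrier A \<and> \<theta> x z) = (\<lambda>z. z \<in> carrier A \<and> \<theta> y z)"
      using xy trans sym by blast
    then show "q x = q y"
      by (simp add: q_def)
  qed
  define D where "D = \<lparr> carrier = q ` carrier A,
    join = (\<lambda>x y. q (join A x y)), cmpl = (\<lambda>x. q (cmpl A x)),
    rmult = (\<lambda>x y. q (rmult A x y)), conv = (\<lambda>x. q (conv A x)), ident = q (ident A) \<rparr>"
  have "is_alg D"
    using A q by (simp add: is_alg_def D_def)
  moreover have "is_hom q A D"
  proof -
    have "q (join A x y) = q (join A (q x) (q y))" "q (rmult A x y) = q (rmult A (q x) (q y))"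
      "q (cmpl A x) = q (cmpl A (q x))" "q (conv A x) = q (conv A (q x))"
      if xy: "x \<in> carrier A" "y \<in> carrier A" for x y
    proof -
      have "\<theta> (join A x y) (join A (q x) (q y))" "\<theta> (rmult A x y) (rmult A (q x) (q y))"
        "\<theta> (cmpl A x) (cmpl A (q x))" "\<theta> (conv A x) (conv A (q x))"
        using q[OF xy(1)] q[OF xy(2)] xy \<theta> unfolding congruence_def by blast+
      then show "q (join A x y) = q (join A (q x) (q y))"
        "q (rmult A x y) = q (rmult A (q x) (q y))"
        "q (cmpl A x) = q (cmpl A (q x))" "q (conv A x) = q (conv A (q x))"
        using q[OF xy(1)] q[OF xy(2)] xy A by (simp_all add: q_iff is_alg_def)
    qed
    then show ?thesis
      by (simp add: is_hom_def D_def)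
  qed
  moreover have "q ` carrier A = carrier D"
    by (simp add: D_def)
  ultimately show thesis
    using q_iff that by blast
qed

section \<open>The two inclusions for general classes\<close>

lemma SH_subset_HS:
  fixes K :: "'a alg set"
  assumes K: "\<And>A. A \<in> K \<Longrightarrow> is_alg A"
  shows "(S_cls (H_cls K :: 'c alg set) :: 'b alg set) \<subseteq> H_cls (S_cls K :: 'a alg set)"
proof
  fix B :: "'b alg"
  assume "B \<in> S_cls (H_cls K :: 'c alg set)"
  then obtain D C :: "'c alg" where B: "is_alg B" and D: "D \<in> H_cls K"
    and C: "subalgebra C D" and BC: "isomorphic B C"
    by (auto simp: S_cls_def)
  obtain A h where A: "A \<in> K" and h: "is_hom h A D" and im: "h ` carrier A = carrier D"
    using D by (auto simp: H_cls_def)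
  obtain g where g: "is_hom g C B" "bij_betw g (carrier C) (carrier B)"
    using isomorphic_sym[OF B BC] by (auto simp: isomorphic_def)
  \<comment> \<open>The preimage of \<open>C\<close> under \<open>h\<close>, with the operations of
    \<open>A\<close>; \<open>g \<circ> h\<close> then maps it onto \<open>B\<close>.\<close>
  define A' where "A' = A\<lparr>carrier := {x \<in> carrier A. h x \<in> carrier C}\<rparr>"
  have hC: "h ` carrier A' = carrier C"
    using C im by (auto simp: A'_def subalgebra_def)
  have "is_alg A'"
    using K[OF A] h C by (auto simp: A'_def is_alg_def is_hom_def subalgebra_def)
  then have "subalgebra A' A"
    by (auto simp: subalgebra_def A'_def)
  then have "A' \<in> S_cls K"
    using A \<open>is_alg A'\<close> isomorphic_refl unfolding S_cls_def by blast
  moreover have "is_hom h A' C"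
    using h C by (auto simp: A'_def is_hom_def subalgebra_def)
  then have "is_hom (g \<circ> h) A' B"
    using g(1) by (rule is_hom_comp)
  moreover have "(g \<circ> h) ` carrier A' = carrier B"
    unfolding image_comp[symmetric] hC using g(2) by (rule bij_betw_imp_surj_on)
  ultimately show "B \<in> H_cls (S_cls K :: 'a alg set)"
    using B unfolding H_cls_def by blast
qed

text \<open>The hypothesis \<open>cep\<close> extends the kernel of \<open>f\<close> from
  \<open>C\<close> to a congruence of \<open>A\<close>. On \<open>C\<close> the quotient map of
  \<open>A\<close> then has the same kernel as \<open>f\<close>, so \<open>B\<close> is isomorphic
  to the image of \<open>C\<close>, a subalgebra of the quotient.\<close>

lemma HS_subset_SH_if_congruence_extension:
  fixes K :: "'a alg set"
  assumes K: "\<And>A. A \<in> K \<Longrightarrow> is_alg A"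
    and cep: "\<And>A C f (B :: 'b alg). \<lbrakk>A \<in> K; subalgebra C A; is_hom f C B\<rbrakk> \<Longrightarrow>
      \<exists>\<theta>. congruence A \<theta> \<and> (\<forall>x\<in>carrier C. \<forall>y\<in>carrier C. \<theta> x y \<longleftrightarrow> f x = f y)"
  shows "(H_cls (S_cls K :: 'c alg set) :: 'b alg set) \<subseteq> S_cls (H_cls K :: 'a alg set)"
proof
  fix B :: "'b alg"
  assume "B \<in> H_cls (S_cls K :: 'c alg set)"
  then obtain C' :: "'c alg" and h where B: "is_alg B" and C': "C' \<in> S_cls K"
    and h: "is_hom h C' B" "h ` carrier C' = carrier B"
    by (auto simp: H_cls_def)
  obtain A C where A: "A \<in> K" and C: "subalgebra C A" and iso: "isomorphic C' C"
    and "is_alg C'"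
    using C' by (auto simp: S_cls_def)
  obtain g where g: "is_hom g C C'" "bij_betw g (carrier C) (carrier C')"
    using isomorphic_sym[OF \<open>is_alg C'\<close> iso] by (auto simp: isomorphic_def)
  \<comment> \<open>\<open>C'\<close> is only isomorphic to a subalgebra; composing with
    \<open>g\<close> presents \<open>B\<close> as an image of the subalgebra \<open>C\<close>
    itself.\<close>
  define f where "f = h \<circ> g"
  have f: "is_hom f C B"
    unfolding f_def using g(1) h(1) by (rule is_hom_comp)
  have fim: "f ` carrier C = carrier B"
    unfolding f_def image_comp[symmetric] bij_betw_imp_surj_on[OF g(2)] by (rule h(2))
  obtain \<theta> where \<theta>: "congruence A \<theta>"
    and ext: "\<forall>x\<in>carrier C. \<forall>y\<in>carrier C. \<theta> x y \<longleftrightarrow> f x = f y"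
    using cep[OF A C f] by blast
  obtain D :: "'a alg" and q where D: "is_alg D" and q: "is_hom q A D" "q ` carrier A = carrier D"
    and ker: "\<And>x y. x \<in> carrier A \<Longrightarrow> y \<in> carrier A \<Longrightarrow> q x = q y \<longleftrightarrow> \<theta> x y"
    by (rule quotient_exists[OF K[OF A] \<theta>]) (rule that)
  have "is_alg C" and sub: "\<And>x. x \<in> carrier C \<Longrightarrow> x \<in> carrier A"
    using C by (auto simp: subalgebra_def)
  define D' where "D' = D\<lparr>carrier := q ` carrier C\<rparr>"
  have qC: "is_hom q C D'"
    using q(1) C sub by (auto simp: is_hom_def subalgebra_def D'_def)
  \<comment> \<open>Closure is inherited from \<open>C\<close>, because the operations on images
    under \<open>q\<close> are the images of the operations of \<open>C\<close>.\<close>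
  have "is_alg D'"
    unfolding is_alg_def
  proof (intro conjI ballI)
    fix x y
    assume "x \<in> carrier D'" "y \<in> carrier D'"
    then obtain u v where uv: "u \<in> carrier C" "v \<in> carrier C" "x = q u" "y = q v"
      by (auto simp: D'_def)
    have "join D' x y = q (join C u v)" "rmult D' x y = q (rmult C u v)"
      using qC uv by (auto simp: is_hom_def)
    then show "join D' x y \<in> carrier D'" "rmult D' x y \<in> carrier D'"
      using \<open>is_alg C\<close> uv by (auto simp: is_alg_def D'_def)
  next
    fix x
    assume "x \<in> carrier D'"
    then obtain u where u: "u \<in> carrier C" "x = q u"
      by (auto simp: D'_def)
    have "cmpl D' x = q (cmpl C u)" "conv D' x = q (conv C u)"
      using qC u by (auto simp: is_hom_def)
    then show "cmpl D' x \<in> carrier D'" "conv D' x \<in> carrier D'"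
      using \<open>is_alg C\<close> u by (auto simp: is_alg_def D'_def)
  next
    have "ident D' = q (ident C)"
      using qC by (simp add: is_hom_def)
    then show "ident D' \<in> carrier D'"
      using \<open>is_alg C\<close> by (auto simp: is_alg_def D'_def)
  qed
  then have "subalgebra D' D"
    using q(2) sub by (auto simp: subalgebra_def D'_def)
  moreover have "isomorphic B D'"
    by (rule isomorphic_if_same_kernel[OF \<open>is_alg C\<close> f fim qC])
      (auto simp: D'_def ker ext sub)
  moreover have "D \<in> H_cls K"
    using A D q unfolding H_cls_def by blast
  ultimately show "B \<in> S_cls (H_cls K :: 'a alg set)"
    using B unfolding S_cls_def by blast
qed

section \<open>Congruence extension for the algebras \<open>Sb E\<close>\<close>

lemma Sb_congruence_extension:
  assumes C: "subalgebra C (Sb E)" and f: "is_hom f C B"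
  shows "\<exists>\<theta>. congruence (Sb E) \<theta> \<and> (\<forall>x\<in>carrier C. \<forall>y\<in>carrier C. \<theta> x y \<longleftrightarrow> f x = f y)"
proof -
  have CE: "x \<subseteq> E" if "x \<in> carrier C" for x
    using C that by (auto simp: subalgebra_def Sb_def)
  have cl: "x \<union> y \<in> carrier C" "E - x \<in> carrier C" "x O y \<in> carrier C" "x\<inverse> \<in> carrier C"
    if "x \<in> carrier C" "y \<in> carrier C" for x y
    using C that unfolding subalgebra_def is_alg_def by (force simp: Sb_def)+
  have hom: "f (x \<union> y) = join B (f x) (f y)" "f (E - x) = cmpl B (f x)"
    "f (x O y) = rmult B (f x) (f y)" "f (x\<inverse>) = conv B (f x)"
    if "x \<in> carrier C" "y \<in> carrier C" for x y
    using C f that unfolding subalgebra_def is_hom_def by (simp_all add: Sb_def)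
  \<comment> \<open>Any element joined with its complement gives \<open>E\<close>, and the
    complement of \<open>E\<close> gives \<open>{}\<close>; so both lie in \<open>C\<close>.\<close>
  obtain i where i: "i \<in> carrier C"
    using C by (auto simp: subalgebra_def is_alg_def)
  have "i \<union> (E - i) = E"
    using CE[OF i] by blast
  then have EC: "E \<in> carrier C"
    using cl i by metis
  then have eC: "{} \<in> carrier C"
    using cl(2)[OF EC EC] by simp
  define I where "I = {u \<in> carrier C. f u = f {}}"
  have I_Un: "u \<union> v \<in> I" if "u \<in> I" "v \<in> I" for u v
    using that hom(1)[of u v] hom(1)[OF eC eC] cl(1)[of u v] by (simp add: I_def)
  have I_conv: "u\<inverse> \<in> I" if "u \<in> I" for u
    using that hom(4)[of u u] hom(4)[OF eC eC] cl(4)[of u u] by (simp add: I_def)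
  \<comment> \<open>Since \<open>f u = f {}\<close>, the value \<open>f (E O u)\<close> equals
    \<open>f (E O {})\<close>, which is \<open>f {}\<close>.\<close>
  have I_left: "E O u \<in> I" if "u \<in> I" for u
    using that hom(3)[of E u] hom(3)[OF EC eC] cl(3)[of E u] EC by (simp add: I_def)
  have I_right: "u O E \<in> I" if "u \<in> I" for u
    using that hom(3)[of u E] hom(3)[OF eC EC] cl(3)[of u E] EC by (simp add: I_def)
  \<comment> \<open>Equality modulo the ideal: \<open>x\<close> and \<open>y\<close> differ only
    inside some member of \<open>I\<close>.\<close>
  define \<theta> where "\<theta> x y \<longleftrightarrow> (\<exists>u\<in>I. x \<union> u = y \<union> u)" for x y
  have "congruence (Sb E) \<theta>"
    unfolding congruence_def
  proof (intro conjI ballI impI)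
    fix x y z
    show "\<theta> x x"
      using eC by (auto simp: \<theta>_def I_def)
    show "\<theta> y x" if "\<theta> x y"
      using that by (auto simp: \<theta>_def)
    show "\<theta> x z" if xy: "\<theta> x y" and yz: "\<theta> y z"
    proof -
      obtain u v where I: "u \<in> I" "v \<in> I" and eq: "x \<union> u = y \<union> u" "y \<union> v = z \<union> v"
        using xy yz by (auto simp: \<theta>_def)
      have "x \<union> (u \<union> v) = z \<union> (u \<union> v)"
        using eq by blast
      then show ?thesis
        unfolding \<theta>_def using I_Un[OF I] by (rule bexI)
    qed
  next
    fix x y x' y'
    assume "x \<in> carrier (Sb E)" "y \<in> carrier (Sb E)" "x' \<in> carrier (Sb E)" "y' \<in> carrier (Sb E)"
      and "\<theta> x y" "\<theta> x' y'"
    then have sub: "x \<subseteq> E" "y \<subseteq> E" "x' \<subseteq> E" "y' \<subseteq> E"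
      by (simp_all add: Sb_def)
    obtain u v where u: "u \<in> I" "x \<union> u = y \<union> u" and v: "v \<in> I" "x' \<union> v = y' \<union> v"
      using \<open>\<theta> x y\<close> \<open>\<theta> x' y'\<close> by (auto simp: \<theta>_def)
    have "(x \<union> x') \<union> (u \<union> v) = (y \<union> y') \<union> (u \<union> v)"
      using u v by blast
    then show "\<theta> (join (Sb E) x x') (join (Sb E) y y')"
      using I_Un[OF u(1) v(1)] unfolding \<theta>_def Sb_def alg.simps by (rule bexI)
    \<comment> \<open>Replacing one factor at a time, the first replacement costs
      \<open>u O a'\<close> and the second \<open>b O v\<close>; the bounds by \<open>E\<close> put
      these errors inside members of \<open>I\<close>.\<close>
    have comp_le: "a O a' \<subseteq> b O b' \<union> (u O E \<union> E O v)"
      if "a \<subseteq> b \<union> u" "a' \<subseteq> b' \<union> v" "a' \<subseteq> E" "b \<subseteq> E" for a a' b b'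
    proof -
      have "a O a' \<subseteq> b O a' \<union> u O a'"
        using relcomp_mono[OF that(1) order_refl] by simp
      also have "\<dots> \<subseteq> (b O b' \<union> b O v) \<union> u O E"
        using relcomp_mono[OF order_refl that(2), of b] that(3)
        by (intro Un_mono relcomp_mono) simp_all
      also have "\<dots> \<subseteq> (b O b' \<union> E O v) \<union> u O E"
        using that(4) by (intro Un_mono relcomp_mono order_refl)
      finally show ?thesis
        by (simp only: Un_ac)
    qed
    have "x O x' \<subseteq> y O y' \<union> (u O E \<union> E O v)" "y O y' \<subseteq> x O x' \<union> (u O E \<union> E O v)"
      by (rule comp_le; use u v sub in blast)+
    then have "x O x' \<union> (u O E \<union> E O v) = y O y' \<union> (u O E \<union> E O v)"
      by (intro equalityI le_supI[OF _ sup_ge2])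
    moreover have "u O E \<union> E O v \<in> I"
      using u v by (intro I_Un I_left I_right)
    ultimately show "\<theta> (rmult (Sb E) x x') (rmult (Sb E) y y')"
      unfolding \<theta>_def Sb_def alg.simps by (rule bexI)
  next
    fix x y
    assume "\<theta> x y"
    then obtain u where u: "u \<in> I" "x \<union> u = y \<union> u"
      by (auto simp: \<theta>_def)
    \<comment> \<open>Outside \<open>u\<close> the relations \<open>x\<close> and \<open>y\<close>
      agree, hence so do their complements.\<close>
    have "(E - x) \<union> u = (E - y) \<union> u"
      using u by blast
    then show "\<theta> (cmpl (Sb E) x) (cmpl (Sb E) y)"
      using u(1) unfolding \<theta>_def Sb_def alg.simps by (rule bexI)
    have "x\<inverse> \<union> u\<inverse> = y\<inverse> \<union> u\<inverse>"
      using u by (metis converse_Un)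
    then show "\<theta> (conv (Sb E) x) (conv (Sb E) y)"
      using I_conv[OF u(1)] unfolding \<theta>_def Sb_def alg.simps by (rule bexI)
  qed
  moreover have "\<theta> x y \<longleftrightarrow> f x = f y" if xy: "x \<in> carrier C" "y \<in> carrier C" for x y
  proof
    \<comment> \<open>Under \<open>f\<close>, joining \<open>u\<close> has the same effect as
      joining \<open>{}\<close>.\<close>
    have absorb: "f (z \<union> u) = f z" if "z \<in> carrier C" "u \<in> I" for z u
      using that hom(1)[of z u] hom(1)[of z "{}"] eC by (simp add: I_def)
    assume "\<theta> x y"
    then obtain u where "u \<in> I" "x \<union> u = y \<union> u"
      by (auto simp: \<theta>_def)
    then show "f x = f y"
      using absorb xy by metis
  next
    assume eq: "f x = f y"
    \<comment> \<open>Both \<open>a - b\<close> and \<open>b - b = {}\<close> are values of one term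
      in join and complement, so \<open>f a = f b\<close> makes \<open>f\<close> agree on
      them.\<close>
    have diff: "a - b \<in> I" if ab: "a \<in> carrier C" "b \<in> carrier C" "f a = f b" for a b
    proof -
      have "a - b = E - ((E - a) \<union> b)"
        using CE[OF ab(1)] by blast
      moreover have "{} = E - ((E - b) \<union> b)"
        by blast
      moreover have "f (E - ((E - a) \<union> b)) = f (E - ((E - b) \<union> b))"
        using ab cl by (simp only: hom)
      moreover have "E - ((E - a) \<union> b) \<in> carrier C"
        using ab cl by blast
      ultimately show ?thesis
        unfolding I_def by (metis (mono_tags, lifting) mem_Collect_eq)
    qed
    \<comment> \<open>The symmetric difference is the witness for
      \<open>\<theta> x y\<close>.\<close>
    have "(x - y) \<union> (y - x) \<in> I"
      using diff xy eq by (intro I_Un) auto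
    moreover have "x \<union> ((x - y) \<union> (y - x)) = y \<union> ((x - y) \<union> (y - x))"
      by blast
    ultimately show "\<theta> x y"
      unfolding \<theta>_def by (intro bexI)
  qed
  ultimately show ?thesis
    by blast
qed

text \<open>Taking the intermediate classes over \<open>'a rel\<close> loses nothing up to
  isomorphism, by \<open>H_cls_same_type\<close> and \<open>S_cls_same_type\<close>.\<close>

theorem theorem3p2p4:
  "(H_cls (S_cls (Sb_cls :: 'a rel alg set) :: 'a rel alg set) :: 'b alg set) =
   S_cls (H_cls (Sb_cls :: 'a rel alg set) :: 'a rel alg set)"
proof
  have alg: "is_alg A" if "A \<in> Sb_cls" for A :: "'a rel alg"
    using that is_alg_Sb by (auto simp: Sb_cls_def)
  show "(H_cls (S_cls (Sb_cls :: 'a rel alg set) :: 'a rel alg set) :: 'b alg set) \<subseteq>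
    S_cls (H_cls (Sb_cls :: 'a rel alg set) :: 'a rel alg set)"
  proof (rule HS_subset_SH_if_congruence_extension[OF alg])
    fix A C :: "'a rel alg" and f and B :: "'b alg"
    assume "A \<in> Sb_cls" and C: "subalgebra C A" and f: "is_hom f C B"
    then obtain E where "A = Sb E"
      by (auto simp: Sb_cls_def)
    then show "\<exists>\<theta>. congruence A \<theta> \<and> (\<forall>x\<in>carrier C. \<forall>y\<in>carrier C. \<theta> x y \<longleftrightarrow> f x = f y)"
      using Sb_congruence_extension[of C E f B] C f by simp
  qed
  show "S_cls (H_cls (Sb_cls :: 'a rel alg set) :: 'a rel alg set) \<subseteq>
    (H_cls (S_cls (Sb_cls :: 'a rel alg set) :: 'a rel alg set) :: 'b alg set)"
    by (rule SH_subset_HS[OF alg])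
qed

end
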